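(* Let $\lambda\in(-\pi/2,\pi/2)$ and let $f=h+\overline{g}$ be of the form $h(z)=z+\sum_{n=2}^\infty a_nz^n$, $g(z)=\sum_{n=1}^\infty b_nz^n$, such that $$\sum_{n=2}^\infty\frac{A_n}{B}|a_n|+\sum_{n=1}^\infty\frac{A_n}{B}|b_n|\leq 1,$$ where $A_n=|1+ne^{-i\lambda}|+|1-ne^{-i\lambda}|$ for $n\ge 1$ and $B=|1+e^{-i\lambda}|-|1-e^{-i\lambda}|$. Then $f$ is a harmonic hereditarily $\lambda$-spirallike function.
   Context: $\mathbb{D}=\{z\in\mathbb{C}:|z|<1\}$ and $\mathbb{D}_r=\{z\in\mathbb{C}:|z|<r\}$. Here $h$ and $g$ are analytic in $\mathbb{D}$ with complex coefficients $a_n,b_n$, so $f=h+\overline{g}$ is a complex-valued harmonic function in $\mathbb{D}$. $\mathcal{H}$ is the class of all such harmonic functions $f=h+\overline{g}$ (with $h,g$ of the form above) that are sense-preserving in $\mathbb{D}$, i.e. whose Jacobian $J_f=|h'|^2-|g'|^2$ is positive. For $\lambda\in(-\pi/2,\pi/2)$, a domain $\Omega$ containing the origin is $\lambda$-spirallike if for each $w_0\in\Omega$ the arc of $\lambda$-spiral from the origin to $w_0$, namely $\{w_0\exp(-e^{i\lambda}t):t\ge 0\}\cup\{0\}$, lies entirely in $\Omega$. A harmonic function $f\in\mathcal{H}$ is called hereditarily $\lambda$-spirallike if $f$ is univalent (injective) on $\mathbb{D}$ and $f(\mathbb{D}_r)$ is a $\lambda$-spirallike domain for each $0<r<1$.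
   Formalization: The hypothesis |b_1|<1 is added: for λ=0 the printed condition admits f=z+b_1·conj(z) with |b_1|=1 (e.g. 2Re z), which is neither injective nor sense-preserving; only these functions are excluded, since for λ≠0 the condition already gives |b_1|<1. *)

theory Defs
  imports "HOL-Complex_Analysis.Complex_Analysis"
begin

definition coeff_A :: "real \<Rightarrow> nat \<Rightarrow> real" where
  "coeff_A l n = cmod (1 + of_nat n * exp (- (\<i> * of_real l)))
               + cmod (1 - of_nat n * exp (- (\<i> * of_real l)))"

definition coeff_B :: "real \<Rightarrow> real" where
  "coeff_B l = cmod (1 + exp (- (\<i> * of_real l))) - cmod (1 - exp (- (\<i> * of_real l)))"

definition normalized_pair ::
    "(nat \<Rightarrow> complex) \<Rightarrow> (nat \<Rightarrow> complex) \<Rightarrow> (complex \<Rightarrow> complex) \<Rightarrow> (complex \<Rightarrow> complex) \<Rightarrow> bool" where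
  "normalized_pair a b h g \<longleftrightarrow>
     h holomorphic_on ball 0 1 \<and> g holomorphic_on ball 0 1 \<and>
     (\<forall>z \<in> ball 0 1. ((\<lambda>n. a n * z ^ n) has_sum (h z - z)) {2..}) \<and>
     (\<forall>z \<in> ball 0 1. ((\<lambda>n. b n * z ^ n) has_sum g z) {1..})"

definition harmonic_jacobian ::
    "(complex \<Rightarrow> complex) \<Rightarrow> (complex \<Rightarrow> complex) \<Rightarrow> complex \<Rightarrow> real" where
  "harmonic_jacobian h g z = (cmod (deriv h z))\<^sup>2 - (cmod (deriv g z))\<^sup>2"

text \<open>The values of \<open>f\<close> outside the unit disc are irrelevant. Since \<open>g 0 = 0\<close>, the
  decomposition \<open>f = h + cnj g\<close> is unique on the disc, so the existential quantifier
  involves no choice.\<close>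

definition harmonic_class :: "(complex \<Rightarrow> complex) set" where
  "harmonic_class = {f. \<exists>a b h g. normalized_pair a b h g \<and>
     (\<forall>z \<in> ball 0 1. f z = h z + cnj (g z)) \<and>
     (\<forall>z \<in> ball 0 1. harmonic_jacobian h g z > 0)}"

definition spiral_arc :: "real \<Rightarrow> complex \<Rightarrow> complex set" where
  "spiral_arc l w = {w * exp (- (exp (\<i> * of_real l) * of_real t)) | t. t \<ge> 0} \<union> {0}"

definition spirallike_domain :: "real \<Rightarrow> complex set \<Rightarrow> bool" where
  "spirallike_domain l \<Omega> \<longleftrightarrow>
     open \<Omega> \<and> connected \<Omega> \<and> 0 \<in> \<Omega> \<and> (\<forall>w \<in> \<Omega>. spiral_arc l w \<subseteq> \<Omega>)"

definition hereditarily_spirallike :: "real \<Rightarrow> (complex \<Rightarrow> complex) \<Rightarrow> bool" where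
  "hereditarily_spirallike l f \<longleftrightarrow>
     f \<in> harmonic_class \<and> inj_on f (ball 0 1) \<and>
     (\<forall>r. 0 < r \<and> r < 1 \<longrightarrow> spirallike_domain l (f ` ball 0 r))"

text \<open>
  Every member of \<open>harmonic_class\<close> has \<open>cmod (b 1) < 1\<close>, because its Jacobian at \<open>0\<close> is
  \<open>1 - (cmod (b 1))\<^sup>2\<close>. This has to be imposed along with the coefficient condition below,
  which by itself admits \<open>f z = z + cnj z\<close> for \<open>l = 0\<close>, a map that is neither injective
  nor sense-preserving. That happens only for \<open>l = 0\<close>: if \<open>l\<close> is a nonzero number in the
  interval from \<open>- pi / 2\<close> to \<open>pi / 2\<close>, then \<open>coeff_A l 1 > coeff_B l > 0\<close> and the
  coefficient condition implies \<open>cmod (b 1) < 1\<close>.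
\<close>

definition coeff_condition :: "real \<Rightarrow> (nat \<Rightarrow> complex) \<Rightarrow> (nat \<Rightarrow> complex) \<Rightarrow> bool" where
  "coeff_condition l a b \<longleftrightarrow>
     (\<lambda>n. coeff_A l n / coeff_B l * cmod (a n)) summable_on {2..} \<and>
     (\<lambda>n. coeff_A l n / coeff_B l * cmod (b n)) summable_on {1..} \<and>
     (\<Sum>\<^sub>\<infinity>n\<in>{2..}. coeff_A l n / coeff_B l * cmod (a n))
       + (\<Sum>\<^sub>\<infinity>n\<in>{1..}. coeff_A l n / coeff_B l * cmod (b n)) \<le> 1"

end

theory Submission
  imports Defs
begin

text \<open>
  Write \<open>Df z = z * h' z - cnj (z * g' z)\<close> and \<open>\<epsilon> = exp (- \<i> l)\<close>. Since \<open>2 n \<le> A\<^sub>n\<close> and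
  \<open>B \<le> 2\<close>, the coefficient condition makes \<open>f - id\<close> a strict contraction on each smaller disc,
  which gives injectivity and a positive Jacobian. Termwise estimates give
  \<open>\<bar>f - \<epsilon> Df\<bar> \<le> \<bar>f + \<epsilon> Df\<bar>\<close>, that is \<open>Re (cnj f * \<epsilon> Df) \<ge> 0\<close>. This says that the pullback
  under \<open>f\<close> of a \<open>l\<close>-spiral moves with nonincreasing modulus, so it never leaves the disc
  \<open>\<bar>z\<bar> < r\<close>. The weak inequality suffices, and equality does occur in the extremal case
  \<open>f z = z + b\<^sub>1 * cnj z\<close>.
\<close>

section \<open>Power series on the unit disc\<close>

lemma norm_sums_le:
  fixes d :: "nat \<Rightarrow> 'a::banach"
  assumes "d sums s" "\<And>n. norm (d n) \<le> e n" "summable e"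
  shows "norm s \<le> suminf e"
  using norm_suminf_le[OF assms(2,3)] sums_unique[OF assms(1)] by simp

lemma power_series_deriv_sums:
  fixes c :: "nat \<Rightarrow> complex"
  assumes F: "\<And>z. norm z < 1 \<Longrightarrow> (\<lambda>n. c n * z ^ n) sums F z" and z: "norm z < 1"
  shows "(\<lambda>n. of_nat (Suc n) * c (Suc n) * z ^ n) sums deriv F z"
    and "(\<lambda>n. of_nat n * c n * z ^ n) sums (z * deriv F z)"
proof -
  have "((\<lambda>z. \<Sum>n. c n * z ^ n) has_field_derivative (\<Sum>n. diffs c n * z ^ n)) (at z)"
    by (rule termdiffs_strong'[where K=1]) (use F z in \<open>auto simp: sums_iff\<close>)
  moreover have "eventually (\<lambda>x. x \<in> ball 0 1) (nhds z)"
    using z by (intro eventually_nhds_in_open) auto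
  then have "eventually (\<lambda>x. (\<Sum>n. c n * x ^ n) = F x) (nhds z)"
    by eventually_elim (use F in \<open>auto simp: sums_iff\<close>)
  ultimately have "(F has_field_derivative (\<Sum>n. diffs c n * z ^ n)) (at z)"
    using DERIV_cong_ev[OF refl _ refl, of "\<lambda>z. \<Sum>n. c n * z ^ n" F z] by simp
  then have "deriv F z = (\<Sum>n. diffs c n * z ^ n)"
    by (rule DERIV_imp_deriv)
  moreover have "summable (\<lambda>n. diffs c n * z ^ n)"
    by (rule termdiff_converges[where K=1]) (use F z in \<open>auto simp: sums_iff\<close>)
  ultimately show 1: "(\<lambda>n. of_nat (Suc n) * c (Suc n) * z ^ n) sums deriv F z"
    unfolding diffs_def using summable_sums by metis
  have "(\<lambda>n. of_nat (Suc n) * c (Suc n) * z ^ Suc n) sums (z * deriv F z)"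
    using sums_mult[OF 1, of z] by (simp add: mult_ac)
  \<comment> \<open>Shifting the index back by one costs nothing: the term at 0 carries the factor
    0.\<close>
  then show "(\<lambda>n. of_nat n * c n * z ^ n) sums (z * deriv F z)"
    using sums_Suc_iff[where f="\<lambda>n. of_nat n * c n * z ^ n"] by simp
qed

text \<open>The bound depends on \<open>z\<close> only through \<open>r\<close>, so it is uniform on
  the closed disc of radius \<open>r\<close>. Keeping the powers of \<open>r\<close>, rather than
  estimating them by 1, is what later yields a strict contraction.\<close>

lemma norm_deriv_le_power_series:
  fixes c :: "nat \<Rightarrow> complex"
  assumes F: "\<And>z. norm z < 1 \<Longrightarrow> (\<lambda>n. c n * z ^ n) sums F z" and z: "norm z \<le> r" "r < 1"
    and c: "summable (\<lambda>n. real n * cmod (c n))"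
  shows "summable (\<lambda>n. real (Suc n) * cmod (c (Suc n)) * r ^ n)"
    and "cmod (deriv F z) \<le> (\<Sum>n. real (Suc n) * cmod (c (Suc n)) * r ^ n)"
proof -
  have r: "0 \<le> r" using z norm_ge_zero[of z] by linarith
  have "summable (\<lambda>n. real (Suc n) * cmod (c (Suc n)))"
    using c summable_Suc_iff[of "\<lambda>n. real n * cmod (c n)"] by simp
  then show s: "summable (\<lambda>n. real (Suc n) * cmod (c (Suc n)) * r ^ n)"
    by (rule summable_comparison_test'[where N=0])
      (use r z in \<open>auto simp: norm_mult intro!: mult_left_le power_le_one\<close>)
  show "cmod (deriv F z) \<le> (\<Sum>n. real (Suc n) * cmod (c (Suc n)) * r ^ n)"
  proof (rule norm_sums_le[OF power_series_deriv_sums(1)[OF F] _ s])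
    show "cmod (of_nat (Suc n) * c (Suc n) * z ^ n) \<le> real (Suc n) * cmod (c (Suc n)) * r ^ n" for n
      unfolding norm_mult norm_power norm_of_nat
      using z by (intro mult_left_mono power_mono) auto
  qed (use z in auto)
qed

section \<open>Estimates with \<open>coeff_A\<close> and \<open>coeff_B\<close>\<close>

lemma exp_ii_cnj: "exp (- (\<i> * of_real l)) = cnj (exp (\<i> * of_real l))"
  by (simp add: exp_cnj)

text \<open>Conjugation preserves both moduli. The symmetry is for the co-analytic part: conjugating
  \<open>cnj G\<close> back to \<open>G\<close> replaces \<open>l\<close> by
  \<open>- l\<close>.\<close>

lemma coeff_A_minus: "coeff_A (- l) n = coeff_A l n"
proof -
  have "cmod (1 + of_nat n * exp (\<i> * of_real l)) = cmod (cnj (1 + of_nat n * exp (\<i> * of_real l)))"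
    "cmod (1 - of_nat n * exp (\<i> * of_real l)) = cmod (cnj (1 - of_nat n * exp (\<i> * of_real l)))"
    by (simp_all only: complex_mod_cnj)
  then show ?thesis unfolding coeff_A_def exp_ii_cnj by (simp add: exp_cnj)
qed

lemma coeff_A_ge: "2 * real n \<le> coeff_A l n"
proof -
  have "cmod ((1 + of_nat n * exp (- (\<i> * of_real l))) - (1 - of_nat n * exp (- (\<i> * of_real l))))
     \<le> coeff_A l n"
    unfolding coeff_A_def by (rule norm_triangle_ineq4)
  moreover have "cmod (2 * (of_nat n * exp (- (\<i> * of_real l)))) = 2 * real n"
    by (simp add: norm_mult exp_ii_cnj)
  ultimately show ?thesis by simp
qed

text \<open>The squared moduli of \<open>1 + exp (- (\<i> * of_real l))\<close> and
  \<open>1 - exp (- (\<i> * of_real l))\<close> are \<open>2 + 2 * cos l\<close> and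
  \<open>2 - 2 * cos l\<close>, and the cosine is positive on the given interval.\<close>

lemma coeff_B_pos:
  assumes "- (pi / 2) < l" "l < pi / 2"
  shows "coeff_B l > 0"
proof -
  have "cos l > 0" using assms by (intro cos_gt_zero_pi) auto
  then have "(cmod (1 - exp (- (\<i> * of_real l))))\<^sup>2 < (cmod (1 + exp (- (\<i> * of_real l))))\<^sup>2"
    unfolding cmod_power2 exp_ii_cnj by (simp add: cis_conv_exp[symmetric] power2_sum power2_diff)
  then show ?thesis
    unfolding coeff_B_def using power2_less_imp_less norm_ge_zero by (metis diff_gt_0_iff_gt)
qed

lemma coeff_B_le: "coeff_B l \<le> 2"
proof -
  have "cmod (1 + exp (- (\<i> * of_real l))) \<le> cmod 1 + cmod (exp (- (\<i> * of_real l)))"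
    by (rule norm_triangle_ineq)
  moreover have "\<dots> = 2" by (simp add: exp_ii_cnj)
  ultimately show ?thesis
    unfolding coeff_B_def using norm_ge_zero[of "1 - exp (- (\<i> * of_real l))"] by linarith
qed

text \<open>The operator \<open>z * deriv F z\<close> multiplies the \<open>n\<close>-th coefficient
  by \<open>n\<close>, so the two functions have coefficients
  \<open>(1 + n * \<epsilon>) * c n\<close> and \<open>(1 - n * \<epsilon>) * c n\<close>, whose
  moduli add up to \<open>coeff_A l n * cmod (c n)\<close>. Vanishing of \<open>c 0\<close> allows a
  factor \<open>norm z\<close> to be taken out of every term.\<close>

lemma norm_add_diff_le_coeff_A:
  fixes c :: "nat \<Rightarrow> complex"
  assumes F: "\<And>z. norm z < 1 \<Longrightarrow> (\<lambda>n. c n * z ^ n) sums F z" and z: "norm z < 1"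
    and c0: "c 0 = 0" and c: "summable (\<lambda>n. coeff_A l n * cmod (c n))"
  defines "\<epsilon> \<equiv> exp (- (\<i> * of_real l))"
  shows "cmod (F z + \<epsilon> * (z * deriv F z)) + cmod (F z - \<epsilon> * (z * deriv F z))
    \<le> norm z * (\<Sum>n. coeff_A l n * cmod (c n))"
proof -
  define e where "e = (\<lambda>n. (cmod (1 + of_nat n * \<epsilon>)) * cmod (c n))"
  define e' where "e' = (\<lambda>n. (cmod (1 - of_nat n * \<epsilon>)) * cmod (c n))"
  have A: "coeff_A l n * cmod (c n) = e n + e' n" for n
    by (simp add: coeff_A_def e_def e'_def \<epsilon>_def algebra_simps)
  have nn: "e n \<ge> 0" "e' n \<ge> 0" for n by (auto simp: e_def e'_def)
  have se: "summable e" "summable e'"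
    by (rule summable_comparison_test'[OF c, where N=0], use nn in \<open>auto simp: A\<close>)+
  have term_le: "cmod (k * c n * z ^ n) \<le> norm z * (cmod k * cmod (c n))" for k n
  proof (cases n)
    case (Suc m)
    have "cmod z ^ m \<le> 1" using z by (intro power_le_one) auto
    then have "norm z * (cmod k * cmod (c n)) * cmod z ^ m \<le> norm z * (cmod k * cmod (c n)) * 1"
      by (intro mult_left_mono) auto
    then show ?thesis by (simp add: norm_mult norm_power Suc mult_ac)
  qed (use c0 in auto)
  have "(\<lambda>n. (1 + of_nat n * \<epsilon>) * c n * z ^ n) sums (F z + \<epsilon> * (z * deriv F z))"
    using sums_add[OF F[OF z] sums_mult[OF power_series_deriv_sums(2)[OF F z], of \<epsilon>]]
    by (simp add: algebra_simps)
  from norm_sums_le[OF this, of "\<lambda>n. norm z * e n"] term_le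
  have 1: "cmod (F z + \<epsilon> * (z * deriv F z)) \<le> (\<Sum>n. norm z * e n)"
    using se by (auto simp: e_def intro: summable_mult)
  have "(\<lambda>n. (1 - of_nat n * \<epsilon>) * c n * z ^ n) sums (F z - \<epsilon> * (z * deriv F z))"
    using sums_diff[OF F[OF z] sums_mult[OF power_series_deriv_sums(2)[OF F z], of \<epsilon>]]
    by (simp add: algebra_simps)
  from norm_sums_le[OF this, of "\<lambda>n. norm z * e' n"] term_le
  have 2: "cmod (F z - \<epsilon> * (z * deriv F z)) \<le> (\<Sum>n. norm z * e' n)"
    using se by (auto simp: e'_def intro: summable_mult)
  show ?thesis
    using 1 2 se by (simp add: A suminf_add[symmetric] suminf_mult distrib_left)
qed

section \<open>Sense-preserving harmonic maps and the spiral inequality\<close>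

lemma has_derivative_harmonic:
  assumes "h field_differentiable at z" "g field_differentiable at z"
  shows "((\<lambda>z. h z + cnj (g z)) has_derivative (\<lambda>v. deriv h z * v + cnj (deriv g z * v))) (at z)"
proof -
  have "(h has_derivative (\<lambda>v. deriv h z * v)) (at z)" "(g has_derivative (\<lambda>v. deriv g z * v)) (at z)"
    using assms by (simp_all add: field_differentiable_derivI has_field_derivative_imp_has_derivative)
  then show ?thesis by (intro derivative_intros)
qed

text \<open>While the spiral stays in the image of the unit disc, its preimage under
  \<open>f\<close> is a differentiable curve. The derivative of its squared modulus is
  \<open>- 2\<close> times the real part in \<open>sp\<close>, divided by the Jacobian, hence
  nonpositive. A continuation argument extends this up to time \<open>T\<close>.\<close>

lemma harmonic_spiral_preimage:
  fixes f h g :: "complex \<Rightarrow> complex"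
  assumes h: "h holomorphic_on ball 0 1" and g: "g holomorphic_on ball 0 1"
    and f: "\<And>z. z \<in> ball 0 1 \<Longrightarrow> f z = h z + cnj (g z)"
    and J: "\<And>z. z \<in> ball 0 1 \<Longrightarrow> harmonic_jacobian h g z > 0"
    and inj: "inj_on f (ball 0 1)"
    and sp: "\<And>z. z \<in> ball 0 1 \<Longrightarrow>
      Re (cnj (f z) * (exp (- (\<i> * of_real l)) * (z * deriv h z - cnj (z * deriv g z)))) \<ge> 0"
    and z0: "z0 \<in> ball 0 1" and T: "T \<ge> 0"
  shows "f z0 * exp (- (exp (\<i> * of_real l) * of_real T)) \<in> f ` cball 0 (norm z0)"
proof (rule ccontr)
  assume neg: "\<not> ?thesis"
  define \<omega> where "\<omega> = exp (\<i> * of_real l)"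
  define w where "w t = f z0 * exp (- (\<omega> * of_real t))" for t :: real
  define C where "C = f ` cball 0 (norm z0)"
  define \<phi> where "\<phi> = inv_into (ball 0 1) f"
  have sub: "cball 0 (norm z0) \<subseteq> ball 0 1" using z0 by auto
  have \<phi>f: "\<phi> (f z) = z" if "z \<in> ball 0 1" for z
    unfolding \<phi>_def using inj that by simp
  have contf: "continuous_on (ball 0 1) f"
  proof -
    have "continuous_on (ball 0 1) (\<lambda>z. h z + cnj (g z))"
      using h g by (intro continuous_intros holomorphic_on_imp_continuous_on)
    then show ?thesis using f by (subst continuous_on_cong[OF refl f]) auto
  qed
  have openW: "open (f ` ball 0 1)"
    using invariance_of_domain[OF contf _ inj] by simp
  have Ccl: "compact C"
    unfolding C_def using compact_continuous_image continuous_on_subset[OF contf sub] compact_cball by blast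
  have dw: "(w has_vector_derivative - (\<omega> * w t)) (at t)" for t
  proof -
    have "((\<lambda>x. f z0 * exp (- (\<omega> * x))) has_field_derivative - (\<omega> * w t)) (at (of_real t))"
      unfolding w_def by (auto intro!: derivative_eq_intros)
    then show ?thesis unfolding w_def by (rule has_vector_derivative_real_field)
  qed
  have contw: "continuous_on X w" for X
    unfolding w_def by (intro continuous_intros)
  have mono: "\<exists>d\<le>0. ((\<lambda>s. \<phi> (w s) \<bullet> \<phi> (w s)) has_real_derivative d) (at t)"
    if wt: "w t \<in> f ` ball 0 1" for t
  proof -
    from wt obtain z where z: "z \<in> ball 0 1" "w t = f z" by blast
    define p where "p = deriv h z"
    define q where "q = deriv g z"
    define D where "D = (cmod p)\<^sup>2 - (cmod q)\<^sup>2"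
    have D: "D > 0" using J[OF z(1)] by (simp add: harmonic_jacobian_def D_def p_def q_def)
    have Dc: "complex_of_real D = p * cnj p - q * cnj q"
      unfolding D_def of_real_diff complex_norm_square ..
    define f' where "f' = (\<lambda>v. p * v + cnj (q * v))"
    \<comment> \<open>Cramer's rule for the real-linear equation
      \<open>p * v + cnj (q * v) = y\<close> and its conjugate, with unknowns \<open>v\<close> and
      \<open>cnj v\<close>; the determinant is the Jacobian \<open>D\<close>.\<close>
    define \<phi>' where "\<phi>' = (\<lambda>y. (cnj p * y - cnj q * cnj y) / of_real D)"
    have hg: "h field_differentiable at z" "g field_differentiable at z"
      using h g z(1) by (auto simp: holomorphic_on_imp_differentiable_at)
    have "((\<lambda>z. h z + cnj (g z)) has_derivative f') (at z)"
      using has_derivative_harmonic[OF hg] by (simp add: f'_def p_def q_def)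
    then have df: "(f has_derivative f') (at z)"
      by (rule has_derivative_transform_within_open[OF _ open_ball z(1)]) (use f in auto)
    have "f' (\<phi>' y) = y" for y
    proof -
      have "f' (\<phi>' y) = y * (p * cnj p - q * cnj q) / of_real D"
        unfolding f'_def \<phi>'_def by (simp add: field_simps flip: add_divide_distrib)
      then show ?thesis using D by (simp add: Dc[symmetric])
    qed
    then have "f' \<circ> \<phi>' = id" by auto
    then have d\<phi>: "(\<phi> has_derivative \<phi>') (at (w t))"
      unfolding z(2)
      using has_derivative_inverse_strong[OF _ z(1) contf _ df] \<phi>f by (metis open_ball)
    define v where "v = \<phi>' (- (\<omega> * w t))"
    have d\<zeta>: "((\<lambda>s. \<phi> (w s)) has_vector_derivative v) (at t)"
    proof -
      have "((\<lambda>s. \<phi> (w s)) has_derivative (\<lambda>s. \<phi>' (s *\<^sub>R - (\<omega> * w t)))) (at t)"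
        using has_derivative_compose[OF dw[unfolded has_vector_derivative_def] d\<phi>] .
      moreover have "\<phi>' (s *\<^sub>R - (\<omega> * w t)) = s *\<^sub>R v" for s
        unfolding v_def by (rule linear_cmul[OF has_derivative_linear[OF d\<phi>]])
      ultimately show ?thesis by (simp add: has_vector_derivative_def)
    qed
    have "((\<lambda>s. \<phi> (w s) \<bullet> \<phi> (w s)) has_derivative
        (\<lambda>s. \<phi> (w t) \<bullet> (s *\<^sub>R v) + (s *\<^sub>R v) \<bullet> \<phi> (w t))) (at t)"
      using d\<zeta> unfolding has_vector_derivative_def by (intro has_derivative_inner)
    moreover have "(\<lambda>s. \<phi> (w t) \<bullet> (s *\<^sub>R v) + (s *\<^sub>R v) \<bullet> \<phi> (w t)) = (*) (2 * (z \<bullet> v))"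
      using z by (auto simp: \<phi>f inner_commute)
    ultimately have "((\<lambda>s. \<phi> (w s) \<bullet> \<phi> (w s)) has_real_derivative 2 * (z \<bullet> v)) (at t)"
      by (simp add: has_field_derivative_def)
    moreover have "z \<bullet> v \<le> 0"
    proof -
      have "D * (z \<bullet> v) = Re (cnj z * (of_real D * v))"
        by (simp add: inner_complex_def algebra_simps)
      also have "of_real D * v = - (cnj p * (\<omega> * f z) - cnj q * cnj (\<omega> * f z))"
        using D by (simp add: v_def \<phi>'_def z(2))
      \<comment> \<open>Only the summand with \<open>cnj p\<close> is conjugated, which leaves its
        real part unchanged; the other one already has the required form.\<close>
      also have "Re (cnj z * \<dots>) = - Re (cnj (f z) * (cnj \<omega> * (z * p - cnj (z * q))))"
        by (simp add: algebra_simps)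
      also have "\<dots> \<le> 0"
        using sp[OF z(1)] by (simp add: p_def q_def \<omega>_def exp_ii_cnj)
      finally show ?thesis using D by (simp add: mult_le_0_iff)
    qed
    ultimately show ?thesis by (intro exI[of _ "2 * (z \<bullet> v)"]) auto
  qed
  \<comment> \<open>At the last time the spiral is in \<open>C\<close> it is still in the open set \<open>f ` ball 0 1\<close>, so the
    monotonicity keeps it in \<open>C\<close> a little longer.\<close>
  define S where "S = {t \<in> {0..T}. w t \<in> C}"
  have Sclosed: "closed S"
    unfolding S_def
    using continuous_closed_preimage[OF contw, of "{0..T}" C] compact_imp_closed[OF Ccl]
    by (simp add: vimage_def Int_def)
  have "0 \<in> S" using T by (auto simp: S_def w_def C_def)
  have bdd: "bdd_above S" by (rule bdd_aboveI[of _ T]) (auto simp: S_def)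
  define m where "m = Sup S"
  have "m \<in> S" unfolding m_def using closed_contains_Sup[OF _ bdd Sclosed] \<open>0 \<in> S\<close> by blast
  then have m: "0 \<le> m" "m \<le> T" "w m \<in> C" by (auto simp: S_def)
  have "m \<noteq> T" using m(3) neg by (auto simp: w_def C_def \<omega>_def)
  then have "m < T" using m by simp
  have "open (w -` (f ` ball 0 1))"
    using openW contw[of UNIV] by (simp add: open_vimage)
  moreover have wm: "w m \<in> f ` ball 0 1" using m(3) sub by (auto simp: C_def)
  ultimately obtain \<delta> where \<delta>: "\<delta> > 0" "cball m \<delta> \<subseteq> w -` (f ` ball 0 1)"
    unfolding open_contains_cball by (meson vimageI2)
  \<comment> \<open>The cap at \<open>T\<close> keeps \<open>s\<close> in the time interval of
    \<open>S\<close>, so that \<open>w s\<close> in \<open>C\<close> contradicts the choice of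
    \<open>m\<close> as supremum.\<close>
  define s where "s = min T (m + \<delta>)"
  have s: "m < s" "s \<le> T" using \<open>m < T\<close> \<delta> by (auto simp: s_def)
  have inW: "w t \<in> f ` ball 0 1" if "m \<le> t" "t \<le> s" for t
    using \<delta>(2) that by (force simp: s_def dist_real_def subset_iff)
  have "\<phi> (w s) \<bullet> \<phi> (w s) \<le> \<phi> (w m) \<bullet> \<phi> (w m)"
    using s mono inW by (intro DERIV_nonpos_imp_nonincreasing[of m s "\<lambda>s. \<phi> (w s) \<bullet> \<phi> (w s)"]) fastforce+
  then have "norm (\<phi> (w s)) \<le> norm (\<phi> (w m))"
    by (simp add: norm_le)
  also have "\<dots> \<le> norm z0" using m(3) z0 by (auto simp: C_def \<phi>f)
  finally have "norm (\<phi> (w s)) \<le> norm z0" .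
  moreover have "f (\<phi> (w s)) = w s"
    using inW[of s] s by (auto simp: \<phi>_def f_inv_into_f)
  ultimately have "w s \<in> C" unfolding C_def by (metis imageI mem_cball_0)
  then have "s \<in> S" using s m by (auto simp: S_def)
  then have "s \<le> m" unfolding m_def using bdd by (rule cSup_upper)
  then show False using s by simp
qed

text \<open>With \<open>X\<close> for \<open>f\<close> and \<open>Y\<close> for the rotated
  derivative term, four times the real part equals
  \<open>(cmod (X + Y))\<^sup>2 - (cmod (X - Y))\<^sup>2\<close>. The identity map contributes
  \<open>(1 + \<epsilon>) * z\<close> and \<open>(1 - \<epsilon>) * z\<close>, whose moduli differ
  by \<open>norm z * coeff_B l\<close>; the perturbations from \<open>H\<close> and \<open>G\<close>
  together use up at most this gap.\<close>

lemma harmonic_spirallike_inequality: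
  fixes a b :: "nat \<Rightarrow> complex"
  assumes H: "\<And>z. norm z < 1 \<Longrightarrow> (\<lambda>n. a n * z ^ n) sums H z"
    and G: "\<And>z. norm z < 1 \<Longrightarrow> (\<lambda>n. b n * z ^ n) sums G z"
    and z: "norm z < 1" and 0: "a 0 = 0" "b 0 = 0"
    and sa: "summable (\<lambda>n. coeff_A l n * cmod (a n))"
    and sb: "summable (\<lambda>n. coeff_A l n * cmod (b n))"
    and le: "(\<Sum>n. coeff_A l n * cmod (a n)) + (\<Sum>n. coeff_A l n * cmod (b n)) \<le> coeff_B l"
  shows "Re (cnj (z + H z + cnj (G z)) *
    (exp (- (\<i> * of_real l)) * (z * (1 + deriv H z) - cnj (z * deriv G z)))) \<ge> 0"
proof -
  define \<epsilon> where "\<epsilon> = exp (- (\<i> * of_real l))"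
  define P where "P = z * deriv H z"
  define Q where "Q = z * deriv G z"
  define X where "X = z + H z + cnj (G z)"
  define Y where "Y = \<epsilon> * (z * (1 + deriv H z) - cnj (z * deriv G z))"
  have 1: "cmod (H z + \<epsilon> * P) + cmod (H z - \<epsilon> * P) \<le> norm z * (\<Sum>n. coeff_A l n * cmod (a n))"
    unfolding \<epsilon>_def P_def using norm_add_diff_le_coeff_A[OF H z 0(1) sa] .
  have "cmod (G z + cnj \<epsilon> * Q) + cmod (G z - cnj \<epsilon> * Q) \<le> norm z * (\<Sum>n. coeff_A l n * cmod (b n))"
    using norm_add_diff_le_coeff_A[OF G z 0(2), of "- l"] sb
    by (simp add: coeff_A_minus \<epsilon>_def Q_def exp_cnj)
  moreover have "cmod (G z + cnj \<epsilon> * Q) = cmod (cnj (G z) + \<epsilon> * cnj Q)"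
    "cmod (G z - cnj \<epsilon> * Q) = cmod (cnj (G z) - \<epsilon> * cnj Q)"
    by (subst complex_mod_cnj[symmetric], simp)+
  ultimately have 2: "cmod (cnj (G z) + \<epsilon> * cnj Q) + cmod (cnj (G z) - \<epsilon> * cnj Q)
      \<le> norm z * (\<Sum>n. coeff_A l n * cmod (b n))" by simp
  have "norm z * ((\<Sum>n. coeff_A l n * cmod (a n)) + (\<Sum>n. coeff_A l n * cmod (b n)))
      \<le> norm z * coeff_B l"
    using le by (intro mult_left_mono) auto
  also have "\<dots> = cmod ((1 + \<epsilon>) * z) - cmod ((1 - \<epsilon>) * z)"
    unfolding coeff_B_def \<epsilon>_def norm_mult by (simp add: algebra_simps)
  finally have 3: "norm z * (\<Sum>n. coeff_A l n * cmod (a n)) + norm z * (\<Sum>n. coeff_A l n * cmod (b n))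
      \<le> cmod ((1 + \<epsilon>) * z) - cmod ((1 - \<epsilon>) * z)" by (simp add: distrib_left)
  \<comment> \<open>The minus sign in front of the co-analytic derivative pairs opposite signs of
    \<open>P\<close> and \<open>cnj Q\<close>. This is harmless, since the bounds control the sum
    over both signs.\<close>
  have plus: "X + Y = (1 + \<epsilon>) * z + ((H z + \<epsilon> * P) + (cnj (G z) - \<epsilon> * cnj Q))"
    unfolding X_def Y_def P_def Q_def by (simp add: algebra_simps)
  have minus: "X - Y = (1 - \<epsilon>) * z + ((H z - \<epsilon> * P) + (cnj (G z) + \<epsilon> * cnj Q))"
    unfolding X_def Y_def P_def Q_def by (simp add: algebra_simps)
  have "cmod (X - Y) \<le> cmod ((1 - \<epsilon>) * z) + (cmod (H z - \<epsilon> * P) + cmod (cnj (G z) + \<epsilon> * cnj Q))"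
    unfolding minus by (meson add_left_mono norm_triangle_ineq order_trans)
  also have "\<dots> \<le> cmod ((1 + \<epsilon>) * z) - (cmod (H z + \<epsilon> * P) + cmod (cnj (G z) - \<epsilon> * cnj Q))"
    using 1 2 3 by linarith
  also have "\<dots> \<le> cmod ((1 + \<epsilon>) * z) - cmod ((H z + \<epsilon> * P) + (cnj (G z) - \<epsilon> * cnj Q))"
    using norm_triangle_ineq[of "H z + \<epsilon> * P" "cnj (G z) - \<epsilon> * cnj Q"] by linarith
  also have "\<dots> \<le> cmod (X + Y)"
    unfolding plus by (rule norm_diff_ineq)
  finally have "(cmod (X - Y))\<^sup>2 \<le> (cmod (X + Y))\<^sup>2" by (simp add: power_mono)
  then have "Re (cnj X * Y) \<ge> 0"
    unfolding cmod_power2 by (simp add: power2_eq_square algebra_simps)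
  then show ?thesis by (simp add: X_def Y_def \<epsilon>_def)
qed

text \<open>All terms but the first shrink by at least the factor \<open>r\<close>, so the sum is at
  most \<open>u 0 + r * (1 - u 0)\<close>. The first term does not shrink, hence the strict bound on
  \<open>u 0\<close>.\<close>

lemma suminf_mult_power_less_1:
  fixes u :: "nat \<Rightarrow> real"
  assumes u: "summable u" "suminf u \<le> 1" "\<And>n. u n \<ge> 0" and u0: "u 0 < 1" and r: "0 \<le> r" "r < 1"
  shows "(\<Sum>n. u n * r ^ n) < 1"
proof -
  have s: "summable (\<lambda>n. u n * r ^ n)"
    by (rule summable_comparison_test'[OF u(1), where N=0])
      (use u r in \<open>auto simp: norm_mult intro!: mult_left_le power_le_one\<close>)
  have "(\<Sum>n. u n * r ^ n) = u 0 + (\<Sum>n. u (Suc n) * r ^ Suc n)"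
    using suminf_split_head[OF s] by simp
  also have "(\<Sum>n. u (Suc n) * r ^ Suc n) \<le> (\<Sum>n. r * u (Suc n))"
  proof (rule suminf_le)
    show "u (Suc n) * r ^ Suc n \<le> r * u (Suc n)" for n
      using mult_left_mono[of "r ^ n" 1 "r * u (Suc n)"] u(3)[of "Suc n"] r
      by (simp add: power_le_one mult_ac)
    show "summable (\<lambda>n. u (Suc n) * r ^ Suc n)"
      using s by (subst summable_Suc_iff)
    show "summable (\<lambda>n. r * u (Suc n))"
      using u(1) by (intro summable_mult) (subst summable_Suc_iff)
  qed
  also have "\<dots> = r * (suminf u - u 0)"
    using u(1) by (simp add: suminf_mult summable_Suc_iff suminf_split_head)
  also have "\<dots> \<le> r * (1 - u 0)"
    using u r by (intro mult_left_mono) auto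
  also have "\<dots> < 1 - u 0" using u0 r by simp
  finally show ?thesis by simp
qed

section \<open>From the coefficient condition to hereditary spirallikeness\<close>

theorem theorem2p2:
  fixes l :: real and a b :: "nat \<Rightarrow> complex" and f h g :: "complex \<Rightarrow> complex"
  assumes "- (pi / 2) < l" and "l < pi / 2"
    and "normalized_pair a b h g"
    and "\<And>z. z \<in> ball 0 1 \<Longrightarrow> f z = h z + cnj (g z)"
    and "cmod (b 1) < 1"
    and "coeff_condition l a b"
  shows "hereditarily_spirallike l f"
proof -
  note f = assms(4)
  define A where "A = coeff_A l"
  define B where "B = coeff_B l"
  have B: "0 < B" "B \<le> 2"
    using coeff_B_pos assms coeff_B_le by (auto simp: B_def)
  have A: "2 * real n \<le> A n" for n using coeff_A_ge by (simp add: A_def)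
  have hol: "h holomorphic_on ball 0 1" "g holomorphic_on ball 0 1"
    and hs: "\<And>z. z \<in> ball 0 1 \<Longrightarrow> ((\<lambda>n. a n * z ^ n) has_sum (h z - z)) {2..}"
    and gs: "\<And>z. z \<in> ball 0 1 \<Longrightarrow> ((\<lambda>n. b n * z ^ n) has_sum g z) {1..}"
    using assms(3) by (auto simp: normalized_pair_def)
  \<comment> \<open>The values \<open>a 0\<close>, \<open>a 1\<close> and \<open>b 0\<close> are
    unconstrained; zero is the right default, since \<open>H\<close> has the linear term of
    \<open>h\<close> removed and \<open>g\<close> vanishes at 0.\<close>
  define a' where "a' n = (if n \<in> {2..} then a n else 0)" for n
  define b' where "b' n = (if n \<in> {1..} then b n else 0)" for n
  define H where "H z = h z - z" for z
  have 0: "a' 0 = 0" "b' 0 = 0" by (auto simp: a'_def b'_def)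
  have Hs: "(\<lambda>n. a' n * z ^ n) sums H z" if "norm z < 1" for z
  proof -
    have "((\<lambda>n. a' n * z ^ n) has_sum H z) UNIV"
      using hs[of z] that unfolding H_def
      by (subst has_sum_cong_neutral[where T="{2..}" and g="\<lambda>n. a n * z ^ n"]) (auto simp: a'_def)
    then show ?thesis by (rule has_sum_imp_sums)
  qed
  have Gs: "(\<lambda>n. b' n * z ^ n) sums g z" if "norm z < 1" for z
  proof -
    have "((\<lambda>n. b' n * z ^ n) has_sum g z) UNIV"
      using gs[of z] that
      by (subst has_sum_cong_neutral[where T="{1..}" and g="\<lambda>n. b n * z ^ n"]) (auto simp: b'_def)
    then show ?thesis by (rule has_sum_imp_sums)
  qed
  have cc: "(\<lambda>n. A n / B * cmod (a n)) summable_on {2..}"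
    "(\<lambda>n. A n / B * cmod (b n)) summable_on {1..}"
    "(\<Sum>\<^sub>\<infinity>n\<in>{2..}. A n / B * cmod (a n)) + (\<Sum>\<^sub>\<infinity>n\<in>{1..}. A n / B * cmod (b n)) \<le> 1"
    using assms(6) by (auto simp: coeff_condition_def A_def B_def)
  have as: "(\<lambda>n. A n / B * cmod (a' n)) sums (\<Sum>\<^sub>\<infinity>n\<in>{2..}. A n / B * cmod (a n))"
  proof (rule has_sum_imp_sums)
    show "((\<lambda>n. A n / B * cmod (a' n)) has_sum (\<Sum>\<^sub>\<infinity>n\<in>{2..}. A n / B * cmod (a n))) UNIV"
      using has_sum_infsum[OF cc(1)]
      by (subst has_sum_cong_neutral[where T="{2..}" and g="\<lambda>n. A n / B * cmod (a n)"]) (auto simp: a'_def)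
  qed
  have bs: "(\<lambda>n. A n / B * cmod (b' n)) sums (\<Sum>\<^sub>\<infinity>n\<in>{1..}. A n / B * cmod (b n))"
  proof (rule has_sum_imp_sums)
    show "((\<lambda>n. A n / B * cmod (b' n)) has_sum (\<Sum>\<^sub>\<infinity>n\<in>{1..}. A n / B * cmod (b n))) UNIV"
      using has_sum_infsum[OF cc(2)]
      by (subst has_sum_cong_neutral[where T="{1..}" and g="\<lambda>n. A n / B * cmod (b n)"]) (auto simp: b'_def)
  qed
  have sAa: "summable (\<lambda>n. A n * cmod (a' n))" and sAb: "summable (\<lambda>n. A n * cmod (b' n))"
    using sums_mult[OF as, of B] sums_mult[OF bs, of B] B(1) by (auto simp: sums_iff)
  have leB: "(\<Sum>n. A n * cmod (a' n)) + (\<Sum>n. A n * cmod (b' n)) \<le> B"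
    using mult_left_mono[OF cc(3), of B] sums_mult[OF as, of B] sums_mult[OF bs, of B] B(1)
    by (simp add: sums_iff distrib_left)
  have nA: "2 * (real n * cmod c) \<le> A n * cmod c" for n and c :: complex
    using mult_right_mono[OF A, of "cmod c" n] by simp
  have sna: "summable (\<lambda>n. real n * cmod (a' n))"
    by (rule summable_comparison_test'[OF sAa, where N=0]) (use nA in \<open>auto simp: norm_mult intro: order_trans[OF _ nA]\<close>)
  have snb: "summable (\<lambda>n. real n * cmod (b' n))"
    by (rule summable_comparison_test'[OF sAb, where N=0]) (use nA in \<open>auto simp: norm_mult intro: order_trans[OF _ nA]\<close>)
  \<comment> \<open>The coefficient of \<open>r ^ n\<close> in the combined bound for the
    derivatives of \<open>H\<close> and \<open>g\<close>. In particular \<open>u 0\<close> is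
    \<open>cmod (b 1)\<close>, as \<open>a' 1\<close> is 0.\<close>
  define u where "u n = real (Suc n) * cmod (a' (Suc n)) + real (Suc n) * cmod (b' (Suc n))" for n
  have u: "summable u" "suminf u \<le> 1"
  proof -
    define v where "v n = real n * cmod (a' n) + real n * cmod (b' n)" for n
    have v: "summable v" unfolding v_def using sna snb by (rule summable_add)
    have uv: "u = (\<lambda>n. v (Suc n))" by (auto simp: u_def v_def)
    show "summable u" unfolding uv using v by (subst summable_Suc_iff)
    have "suminf u = suminf v"
      unfolding uv using suminf_split_head[OF v] by (simp add: v_def)
    \<comment> \<open>The right-hand side is at most \<open>B\<close>, hence at most 2, so the
      factors 2 cancel.\<close>
    moreover have "2 * suminf v \<le> (\<Sum>n. A n * cmod (a' n) + A n * cmod (b' n))"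
      unfolding suminf_mult[OF v, symmetric]
    proof (rule suminf_le)
      show "2 * v n \<le> A n * cmod (a' n) + A n * cmod (b' n)" for n
        using nA[of n "a' n"] nA[of n "b' n"] by (simp add: v_def)
    qed (use v sAa sAb in \<open>auto intro: summable_add summable_mult\<close>)
    ultimately show "suminf u \<le> 1"
      using suminf_add[OF sAa sAb] leB B by simp
  qed
  \<comment> \<open>Here \<open>p + q\<close> is a Lipschitz constant for \<open>f - id\<close> on
    the closed disc. Its strict bound comes from \<open>r < 1\<close> together with
    \<open>cmod (b 1) < 1\<close>.\<close>
  have K: "\<exists>p q. p + q < 1 \<and> (\<forall>z\<in>cball 0 r. cmod (deriv H z) \<le> p \<and> cmod (deriv g z) \<le> q)"
    if r: "0 \<le> r" "r < 1" for r
  proof -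
    define p where "p = (\<Sum>n. real (Suc n) * cmod (a' (Suc n)) * r ^ n)"
    define q where "q = (\<Sum>n. real (Suc n) * cmod (b' (Suc n)) * r ^ n)"
    have "p + q = (\<Sum>n. u n * r ^ n)"
      unfolding p_def q_def u_def
      using r norm_deriv_le_power_series(1)[OF Hs, of 0 r] norm_deriv_le_power_series(1)[OF Gs, of 0 r] sna snb
      by (subst suminf_add) (auto simp: algebra_simps)
    also have "\<dots> < 1"
      using assms(5) by (intro suminf_mult_power_less_1 u r) (auto simp: u_def a'_def b'_def)
    finally have "p + q < 1" .
    moreover have "cmod (deriv H z) \<le> p \<and> cmod (deriv g z) \<le> q" if "z \<in> cball 0 r" for z
      unfolding p_def q_def
      using norm_deriv_le_power_series(2)[OF Hs _ r(2) sna] norm_deriv_le_power_series(2)[OF Gs _ r(2) snb] that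
      by auto
    ultimately show ?thesis by blast
  qed
  have Hhol: "H holomorphic_on ball 0 1"
    unfolding H_def using hol by (intro holomorphic_intros)
  have dh: "deriv h z = 1 + deriv H z" if "z \<in> ball 0 1" for z
  proof -
    have "h field_differentiable at z"
      using hol that by (auto simp: holomorphic_on_imp_differentiable_at)
    then show ?thesis unfolding H_def by (subst deriv_diff) auto
  qed
  have J: "harmonic_jacobian h g z > 0" if z: "z \<in> ball 0 1" for z
  proof -
    obtain p q where "p + q < 1" "cmod (deriv H z) \<le> p" "cmod (deriv g z) \<le> q"
      using K[of "norm z"] z by auto
    moreover have "1 - cmod (deriv H z) \<le> cmod (deriv h z)"
      unfolding dh[OF z] using norm_diff_ineq[of 1 "deriv H z"] by simp
    ultimately have "cmod (deriv g z) < cmod (deriv h z)" by linarith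
    then show ?thesis unfolding harmonic_jacobian_def by (simp add: power_strict_mono)
  qed
  have inj: "inj_on f (ball 0 1)"
  proof (rule inj_onI)
    fix x y assume xy: "x \<in> ball 0 1" "y \<in> ball 0 1" "f x = f y"
    \<comment> \<open>Both points lie in one closed disc inside the unit disc; its convexity gives
      the mean value bounds for \<open>H\<close> and \<open>g\<close>.\<close>
    define r where "r = max (norm x) (norm y)"
    have r: "0 \<le> r" "r < 1" using xy by (auto simp: r_def le_max_iff_disj)
    obtain p q where pq: "p + q < 1"
      "\<forall>z\<in>cball 0 r. cmod (deriv H z) \<le> p \<and> cmod (deriv g z) \<le> q"
      using K[OF r] by blast
    have der: "(F has_field_derivative deriv F z) (at z within cball 0 r)"
      if "F holomorphic_on ball 0 1" "z \<in> cball 0 r" for F z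
      by (rule has_field_derivative_at_within, rule holomorphic_derivI[OF that(1)]) (use that r in auto)
    have xyr: "x \<in> cball 0 r" "y \<in> cball 0 r" by (auto simp: r_def)
    have Hd: "cmod (H x - H y) \<le> p * cmod (x - y)"
      by (rule field_differentiable_bound[of "cball 0 r" H "deriv H"])
        (use der[OF Hhol] pq xyr in auto)
    have Gd: "cmod (g x - g y) \<le> q * cmod (x - y)"
      by (rule field_differentiable_bound[of "cball 0 r" g "deriv g"])
        (use der[OF hol(2)] pq xyr in auto)
    have "x + H x + cnj (g x) = y + H y + cnj (g y)"
      using xy f by (simp add: H_def)
    then have "x - y = - (H x - H y) - cnj (g x - g y)"
      by (simp add: algebra_simps)
    then have "cmod (x - y) \<le> cmod (H x - H y) + cmod (g x - g y)"
      using norm_triangle_ineq4[of "- (H x - H y)" "cnj (g x - g y)"]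
      by (simp only: norm_minus_cancel complex_mod_cnj)
    also have "\<dots> \<le> (p + q) * cmod (x - y)" using Hd Gd by (simp add: distrib_right)
    finally have "(1 - (p + q)) * cmod (x - y) \<le> 0" by (simp add: algebra_simps)
    then show "x = y" using pq(1) by (auto simp: mult_le_0_iff)
  qed
  have sp: "Re (cnj (f z) * (exp (- (\<i> * of_real l)) * (z * deriv h z - cnj (z * deriv g z)))) \<ge> 0"
    if z: "z \<in> ball 0 1" for z
  proof -
    have "f z = z + H z + cnj (g z)" using f[OF z] by (simp add: H_def)
    then show ?thesis
      unfolding dh[OF z]
      using harmonic_spirallike_inequality[OF Hs Gs _ 0, of z l] sAa sAb leB z
      unfolding A_def B_def by (simp only: mem_ball_0)
  qed
  have "spirallike_domain l (f ` ball 0 r)" if r: "0 < r" "r < 1" for r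
  proof -
    have sub: "ball 0 r \<subseteq> ball (0::complex) 1" using r by auto
    have "continuous_on (ball 0 r) (\<lambda>z. h z + cnj (g z))"
      using hol sub by (intro continuous_intros holomorphic_on_imp_continuous_on) (auto intro: holomorphic_on_subset)
    then have cont: "continuous_on (ball 0 r) f"
      using f sub by (subst continuous_on_cong[OF refl, of _ f "\<lambda>z. h z + cnj (g z)"]) auto
    have "f 0 = 0"
      using f[of 0] sums_unique[OF Hs[of 0]] sums_unique[OF Gs[of 0]] 0 by (simp add: H_def)
    then have z: "0 \<in> f ` ball 0 r" using r by (intro image_eqI[of _ _ 0]) auto
    moreover have "spiral_arc l w \<subseteq> f ` ball 0 r" if w: "w \<in> f ` ball 0 r" for w
    proof -
      obtain z0 where z0: "w = f z0" "z0 \<in> ball 0 r" using w by blast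
      then have c: "cball 0 (norm z0) \<subseteq> ball 0 r" by auto
      \<comment> \<open>The spiral from \<open>f z0\<close> stays in the image of the closed disc of
        radius \<open>norm z0\<close>, which is smaller than \<open>r\<close>.\<close>
      have "w * exp (- (exp (\<i> * of_real l) * of_real t)) \<in> f ` ball 0 r" if "t \<ge> 0" for t
        using harmonic_spiral_preimage[OF hol f J inj sp _ that, of z0] z0 sub c by blast
      then show ?thesis using z by (auto simp: spiral_arc_def)
    qed
    moreover have "open (f ` ball 0 r)"
      using invariance_of_domain[OF cont] inj_on_subset[OF inj sub] by simp
    moreover have "connected (f ` ball 0 r)"
      using cont by (intro connected_continuous_image) auto
    ultimately show ?thesis by (auto simp: spirallike_domain_def)
  qed
  moreover have "f \<in> harmonic_class"
    unfolding harmonic_class_def using assms(3) f J by blast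
  ultimately show ?thesis using inj by (simp add: hereditarily_spirallike_def)
qed

end
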